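(* Let $\mathcal{F}=\{\mathbb{X};\,f_1,\dots,f_N\}$ be an iterated function system on a complete metric space $\mathbb{X}$ and let $A$ be a point-fibred attractor of $\mathcal{F}$ with basin $B$. If $\theta\in\mathbb{I}_+$ is full (equivalently, reversible) with respect to $A$ and $\mathcal{F}$, then $$B\subset B_\theta ,$$ where $B_\theta$ is the continuation of $A$ determined by $\theta$.
   Context: An iterated function system (IFS) $\mathcal{F}=\{\mathbb{X};\,f_1,\dots,f_N\}$ is a complete metric space $(\mathbb{X},d_{\mathbb{X}})$ together with finitely many homeomorphisms $f_n:\mathbb{X}\to\mathbb{X}$ of $\mathbb{X}$ onto itself. $H$ is the set of nonempty compact subsets of $\mathbb{X}$ with the Hausdorff metric. For $S\subset\mathbb{X}$, $F(S)=\bigcup_{n=1}^N f_n(S)$, and $F^k$ is the $k$-fold iterate of $F$. An attractor of $\mathcal{F}$ is a set $A\in H$ with $F(A)=A$ for which there is an open set $U\supset A$ such that $F^k(C)\to A$ in the Hausdorff metric for every $C\in H$ with $C\subset U$. The union of all such open sets $U$ is the basin $B=B(A)$ of $A$ (the defining property also holds with $U=B(A)$). $I_+=\{1,\dots,N\}$ and $\mathbb{I}_+=I_+^{\infty}$ (infinite words). For $\iota\in\mathbb{I}_+$, $f_{\iota|k}=f_{\iota_1}\circ\cdots\circ f_{\iota_k}$. The attractor $A$ is point-fibred if for every $\iota\in\mathbb{I}_+$ the limit $\lim_{k\to\infty}f_{\iota|k}(C)$ exists in the Hausdorff metric for all $C\in H$ with $C\subset B(A)$, is a singleton subset of $A$,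 and is independent of $C$. The coding map is $\pi(\iota)=\lim_{k\to\infty}f_{\iota|k}(b)$, independent of $b\in B(A)$; $\iota$ is called an address of the point $\pi(\iota)\in A$. $A^\circ$ is the interior of $A$ in $\mathbb{X}$. For $\theta\in\mathbb{I}_+$ the continuation $B_\theta$ of $A$ is $$B_\theta=A\cup\bigcup_{k\geq 1}f_{\theta_1}^{-1}\circ f_{\theta_2}^{-1}\circ\cdots\circ f_{\theta_k}^{-1}(A).$$ A word $\theta\in\mathbb{I}_+$ is full if there is a nonempty compact set $A'\subset A^\circ$ such that for every positive integer $M$ there exist $n>m\geq M$ with $f_{\theta_n}\circ f_{\theta_{n-1}}\circ\cdots\circ f_{\theta_{m+1}}(A)\subset A'$. A word $\theta\in\mathbb{I}_+$ is reversible if there is $\omega=\omega_1\omega_2\cdots\in\mathbb{I}_+$ that is the address of some point of $A^\circ$ and such that for every pair of positive integers $M,L$ there is an integer $m\geq M$ with $\omega_1\omega_2\cdots\omega_L=\theta_{m+L}\theta_{m+L-1}\cdots\theta_{m+1}$. It is a known earlier result that a word is reversible if and only if it is full. *)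

theory Defs
  imports "HOL-Analysis.Analysis"
begin

text \<open>The underlying space is a type of class \<^class>\<open>complete_space\<close>.  The maps of the system are
  \<open>f 1, ..., f N\<close>; values of \<open>f\<close> at other indices play no role.\<close>

definition ifs :: "nat \<Rightarrow> (nat \<Rightarrow> 'a::complete_space \<Rightarrow> 'a) \<Rightarrow> bool" where
  "ifs N f \<longleftrightarrow> 1 \<le> N \<and> (\<forall>n\<in>{1..N}. homeomorphism UNIV UNIV (f n) (inv (f n)))"

definition nonempty_compacts :: "'a::metric_space set set" where
  "nonempty_compacts = {C. compact C \<and> C \<noteq> {}}"

text \<open>Only meaningful on nonempty compact sets, where both suprema are over bounded nonempty sets.\<close>

definition hausdorff_dist :: "'a::metric_space set \<Rightarrow> 'a set \<Rightarrow> real" where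
  "hausdorff_dist S T = max (SUP x\<in>S. infdist x T) (SUP y\<in>T. infdist y S)"

definition hausdorff_tendsto :: "(nat \<Rightarrow> 'a::metric_space set) \<Rightarrow> 'a set \<Rightarrow> bool" where
  "hausdorff_tendsto S T \<longleftrightarrow> (\<lambda>k. hausdorff_dist (S k) T) \<longlonglongrightarrow> 0"

definition ifs_image :: "nat \<Rightarrow> (nat \<Rightarrow> 'a \<Rightarrow> 'a) \<Rightarrow> 'a set \<Rightarrow> 'a set" where
  "ifs_image N f S = (\<Union>n\<in>{1..N}. f n ` S)"

definition attracts_on ::
    "nat \<Rightarrow> (nat \<Rightarrow> 'a::metric_space \<Rightarrow> 'a) \<Rightarrow> 'a set \<Rightarrow> 'a set \<Rightarrow> bool" where
  "attracts_on N f A U \<longleftrightarrow> open U \<and> A \<subseteq> U \<and>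
     (\<forall>C\<in>nonempty_compacts. C \<subseteq> U \<longrightarrow> hausdorff_tendsto (\<lambda>k. (ifs_image N f ^^ k) C) A)"

definition attractor :: "nat \<Rightarrow> (nat \<Rightarrow> 'a::metric_space \<Rightarrow> 'a) \<Rightarrow> 'a set \<Rightarrow> bool" where
  "attractor N f A \<longleftrightarrow>
     A \<in> nonempty_compacts \<and> ifs_image N f A = A \<and> (\<exists>U. attracts_on N f A U)"

definition basin :: "nat \<Rightarrow> (nat \<Rightarrow> 'a::metric_space \<Rightarrow> 'a) \<Rightarrow> 'a set \<Rightarrow> 'a set" where
  "basin N f A = \<Union>{U. attracts_on N f A U}"

text \<open>An infinite word is indexed from 1: its letters are \<open>\<theta> 1, \<theta> 2, ...\<close>, and \<open>\<theta> 0\<close> is never used.\<close>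

definition words :: "nat \<Rightarrow> (nat \<Rightarrow> nat) set" where
  "words N = {\<theta>. \<forall>k\<ge>1. \<theta> k \<in> {1..N}}"

text \<open>\<open>prefix_comp f \<iota> k\<close> is \<open>f (\<iota> 1) \<circ> f (\<iota> 2) \<circ> ... \<circ> f (\<iota> k)\<close>.\<close>

primrec prefix_comp :: "(nat \<Rightarrow> 'a \<Rightarrow> 'a) \<Rightarrow> (nat \<Rightarrow> nat) \<Rightarrow> nat \<Rightarrow> 'a \<Rightarrow> 'a" where
  "prefix_comp f \<iota> 0 = id"
| "prefix_comp f \<iota> (Suc k) = prefix_comp f \<iota> k \<circ> f (\<iota> (Suc k))"

text \<open>\<open>rev_block_comp f \<theta> m j\<close> is \<open>f (\<theta> (m + j)) \<circ> ... \<circ> f (\<theta> (m + 2)) \<circ> f (\<theta> (m + 1))\<close>.\<close>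

primrec rev_block_comp ::
    "(nat \<Rightarrow> 'a \<Rightarrow> 'a) \<Rightarrow> (nat \<Rightarrow> nat) \<Rightarrow> nat \<Rightarrow> nat \<Rightarrow> 'a \<Rightarrow> 'a" where
  "rev_block_comp f \<theta> m 0 = id"
| "rev_block_comp f \<theta> m (Suc j) = f (\<theta> (m + Suc j)) \<circ> rev_block_comp f \<theta> m j"

definition point_fibred :: "nat \<Rightarrow> (nat \<Rightarrow> 'a::metric_space \<Rightarrow> 'a) \<Rightarrow> 'a set \<Rightarrow> bool" where
  "point_fibred N f A \<longleftrightarrow>
     (\<forall>\<iota>\<in>words N. \<exists>a\<in>A. \<forall>C\<in>nonempty_compacts. C \<subseteq> basin N f A \<longrightarrow>
        hausdorff_tendsto (\<lambda>k. prefix_comp f \<iota> k ` C) {a})"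

text \<open>Well defined when \<open>A\<close> is a point-fibred attractor.\<close>

definition coding_map ::
    "nat \<Rightarrow> (nat \<Rightarrow> 'a::metric_space \<Rightarrow> 'a) \<Rightarrow> 'a set \<Rightarrow> (nat \<Rightarrow> nat) \<Rightarrow> 'a" where
  "coding_map N f A \<iota> =
     (THE a. \<forall>b\<in>basin N f A. (\<lambda>k. prefix_comp f \<iota> k b) \<longlonglongrightarrow> a)"

definition continuation :: "(nat \<Rightarrow> 'a \<Rightarrow> 'a) \<Rightarrow> 'a set \<Rightarrow> (nat \<Rightarrow> nat) \<Rightarrow> 'a set" where
  "continuation f A \<theta> = A \<union> (\<Union>k\<in>{1..}. prefix_comp (\<lambda>n. inv (f n)) \<theta> k ` A)"

definition full_word ::
    "(nat \<Rightarrow> 'a::metric_space \<Rightarrow> 'a) \<Rightarrow> 'a set \<Rightarrow> (nat \<Rightarrow> nat) \<Rightarrow> bool" where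
  "full_word f A \<theta> \<longleftrightarrow>
     (\<exists>A'\<in>nonempty_compacts. A' \<subseteq> interior A \<and>
        (\<forall>M\<ge>1. \<exists>m n. n > m \<and> m \<ge> M \<and> rev_block_comp f \<theta> m (n - m) ` A \<subseteq> A'))"

definition reversible_word ::
    "nat \<Rightarrow> (nat \<Rightarrow> 'a::metric_space \<Rightarrow> 'a) \<Rightarrow> 'a set \<Rightarrow> (nat \<Rightarrow> nat) \<Rightarrow> bool" where
  "reversible_word N f A \<theta> \<longleftrightarrow>
     (\<exists>\<omega>\<in>words N. coding_map N f A \<omega> \<in> interior A \<and>
        (\<forall>M\<ge>1. \<forall>L\<ge>1. \<exists>m\<ge>M. \<forall>i\<in>{1..L}. \<omega> i = \<theta> (m + L + 1 - i)))"

end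

theory Submission
  imports Defs
begin

text \<open>Follow the forward orbit \<open>y m = f (\<theta> m) (... (f (\<theta> 1) x))\<close> of a point \<open>x\<close> of the basin.
  Since the iterated images of \<open>{x}\<close> converge to \<open>A\<close>, this orbit eventually stays in a compact
  subset \<open>K\<close> of the basin.  If \<open>\<omega>\<close> is the address of an interior point of \<open>A\<close>, then a long prefix
  of \<open>\<omega>\<close> maps \<open>K\<close> into \<open>A\<close>; if this prefix occurs reversed and far out in \<open>\<theta>\<close>, then some \<open>y m\<close>
  lies in \<open>A\<close>, i.e. \<open>x\<close> lies in the continuation.  For a full word, such an \<open>\<omega>\<close> comes from a
  Koenig-type argument applied to the reversed words whose maps send \<open>A\<close> into \<open>A'\<close>.\<close>

section \<open>Hausdorff convergence and compactness\<close>

lemma infdist_le_hausdorff_dist: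
  assumes "compact S" "x \<in> S"
  shows "infdist x T \<le> hausdorff_dist S T"
proof -
  have "compact ((\<lambda>x. infdist x T) ` S)"
    by (intro compact_continuous_image assms continuous_intros)
  then have "bdd_above ((\<lambda>x. infdist x T) ` S)"
    by (simp add: bounded_imp_bdd_above compact_imp_bounded)
  then have "infdist x T \<le> (SUP x\<in>S. infdist x T)"
    using assms(2) by (rule cSUP_upper2) auto
  then show ?thesis
    by (simp add: hausdorff_dist_def)
qed

text \<open>A compact \<open>T\<close> keeps a positive distance \<open>e\<close> from the
  complement of \<open>U\<close>, and once the Hausdorff distance is below \<open>e\<close>, no
  point of \<open>S k\<close> can lie outside \<open>U\<close>. Every topological conclusion drawn
  from Hausdorff convergence below goes through this one-sided form.\<close>

lemma hausdorff_tendsto_eventually_subset: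
  assumes lim: "hausdorff_tendsto S T" and S: "\<And>k. compact (S k)"
    and T: "compact T" "T \<noteq> {}" and U: "open U" "T \<subseteq> U"
  shows "eventually (\<lambda>k. S k \<subseteq> U) sequentially"
proof -
  obtain e where e: "e > 0" "\<And>x y. x \<in> T \<Longrightarrow> y \<in> - U \<Longrightarrow> e \<le> dist x y"
  proof (cases "U = UNIV")
    \<comment> \<open>\<open>infdist\<close> to the empty set is 0, so the minimum used in the other
      case would not be positive here.\<close>
    case True
    then show thesis
      using that[of 1] by simp
  next
    case False
    have "continuous_on T (\<lambda>x. infdist x (- U))"
      by (intro continuous_intros)
    from continuous_attains_inf[OF T this] obtain t where
      t: "t \<in> T" "\<And>x. x \<in> T \<Longrightarrow> infdist t (- U) \<le> infdist x (- U)"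
      by blast
    show thesis
    proof
      show "infdist t (- U) > 0"
        using infdist_pos_not_in_closed[of "- U" t] U t(1) False by auto
      show "infdist t (- U) \<le> dist x y" if "x \<in> T" "y \<in> - U" for x y
        using t(2)[OF that(1)] infdist_le[OF that(2), of x] by linarith
    qed
  qed
  have "eventually (\<lambda>k. hausdorff_dist (S k) T < e) sequentially"
    using lim e(1) unfolding hausdorff_tendsto_def by (rule order_tendstoD(2))
  then show ?thesis
  proof eventually_elim
    case (elim k)
    show ?case
    proof (rule subsetI, rule ccontr)
      fix x assume x: "x \<in> S k" "x \<notin> U"
      have "e \<le> infdist x T"
        unfolding infdist_notempty[OF T(2)]
        using e(2) x T(2) by (intro cINF_greatest) (auto simp: dist_commute)
      with infdist_le_hausdorff_dist[OF S x(1), of T] elim show False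
        by simp
    qed
  qed
qed

lemma hausdorff_tendsto_singletons:
  assumes "hausdorff_tendsto (\<lambda>k. {u k}) {a}"
  shows "u \<longlonglongrightarrow> a"
proof (rule topological_tendstoI)
  fix U assume "open U" "a \<in> U"
  then have "eventually (\<lambda>k. {u k} \<subseteq> U) sequentially"
    using hausdorff_tendsto_eventually_subset[OF assms] by simp
  then show "eventually (\<lambda>k. u k \<in> U) sequentially"
    by simp
qed

text \<open>The union of a finite subcover of \<open>A\<close> is open and swallows all but finitely
  many \<open>S k\<close>; the remaining ones form a compact set. Starting at \<open>K\<close>
  allows dropping early terms that may leave the basin.\<close>

lemma compact_Un_UN_tail:
  fixes S :: "nat \<Rightarrow> 'a::topological_space set"
  assumes A: "compact A" and S: "\<And>k. compact (S k)"
    and near: "\<And>U. open U \<Longrightarrow> A \<subseteq> U \<Longrightarrow> eventually (\<lambda>k. S k \<subseteq> U) sequentially"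
  shows "compact (A \<union> (\<Union>k\<in>{K..}. S k))"
proof (rule compactI)
  fix \<C> assume op: "\<forall>U\<in>\<C>. open U" and cov: "A \<union> (\<Union>k\<in>{K..}. S k) \<subseteq> \<Union>\<C>"
  obtain D where D: "D \<subseteq> \<C>" "finite D" "A \<subseteq> \<Union>D"
    using compactE[OF A, of \<C>] op cov by (metis le_sup_iff)
  have "open (\<Union>D)"
    using D(1) op by auto
  then obtain n where n: "\<And>k. k \<ge> n \<Longrightarrow> S k \<subseteq> \<Union>D"
    using near[OF _ D(3)] by (auto simp: eventually_sequentially)
  have "compact (\<Union>k\<in>{K..<n}. S k)"
    by (intro compact_UN S) auto
  moreover have "(\<Union>k\<in>{K..<n}. S k) \<subseteq> \<Union>\<C>"
    using cov by (intro order_trans[OF _ cov] le_supI2 UN_mono) auto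
  ultimately obtain E where E: "E \<subseteq> \<C>" "finite E" "(\<Union>k\<in>{K..<n}. S k) \<subseteq> \<Union>E"
    using compactE[of _ \<C>] op by metis
  have "A \<union> (\<Union>k\<in>{K..}. S k) \<subseteq> \<Union>(D \<union> E)"
  proof -
    have "S k \<subseteq> \<Union>(D \<union> E)" if "k \<ge> K" for k
    proof (cases "k < n")
      case True
      then have "S k \<subseteq> (\<Union>k\<in>{K..<n}. S k)"
        using that by (intro UN_upper) simp
      with E(3) show ?thesis
        by blast
    next
      case False
      with n[of k] show ?thesis
        by auto
    qed
    then show ?thesis
      using D(3) by auto
  qed
  then show "\<exists>C'\<subseteq>\<C>. finite C' \<and> A \<union> (\<Union>k\<in>{K..}. S k) \<subseteq> \<Union>C'"
    using D E by (intro exI[of _ "D \<union> E"]) auto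
qed

section \<open>Compositions of the maps along words\<close>

lemma ifs_continuous: "ifs N f \<Longrightarrow> n \<in> {1..N} \<Longrightarrow> continuous_on UNIV (f n)"
  by (auto simp: ifs_def homeomorphism_def)

lemma ifs_inv: "ifs N f \<Longrightarrow> n \<in> {1..N} \<Longrightarrow> inv (f n) (f n x) = x"
  by (auto simp: ifs_def homeomorphism_def)

lemma wordsD: "\<theta> \<in> words N \<Longrightarrow> k \<ge> 1 \<Longrightarrow> \<theta> k \<in> {1..N}"
  by (simp add: words_def)

lemma continuous_prefix_comp:
  assumes "ifs N f" "\<omega> \<in> words N"
  shows "continuous_on S (prefix_comp f \<omega> k)"
proof -
  have "continuous_on UNIV (prefix_comp f \<omega> k)"
  proof (induction k)
    case (Suc k)
    have "continuous_on UNIV (f (\<omega> (Suc k)))"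
      using assms wordsD[of \<omega> N "Suc k"] by (intro ifs_continuous) auto
    with Suc show ?case
      by (metis continuous_on_compose continuous_on_subset prefix_comp.simps(2) subset_UNIV)
  qed (simp add: continuous_on_id)
  then show ?thesis
    by (rule continuous_on_subset) simp
qed

lemma compact_prefix_comp:
  "ifs N f \<Longrightarrow> \<omega> \<in> words N \<Longrightarrow> compact C \<Longrightarrow> compact (prefix_comp f \<omega> k ` C)"
  by (intro compact_continuous_image continuous_prefix_comp)

lemma compact_ifs_image:
  assumes "ifs N f" "compact C"
  shows "compact ((ifs_image N f ^^ k) C)"
proof (induction k)
  case (Suc k)
  have "compact (f n ` ((ifs_image N f ^^ k) C))" if "n \<in> {1..N}" for n
    using continuous_on_subset[OF ifs_continuous[OF assms(1) that] subset_UNIV] Suc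
    by (rule compact_continuous_image)
  then have "compact (ifs_image N f ((ifs_image N f ^^ k) C))"
    unfolding ifs_image_def[of N f "(ifs_image N f ^^ k) C"] by (intro compact_UN) auto
  then show ?case
    by simp
qed (simp add: assms)

text \<open>With \<open>C = {x}\<close> this locates the orbit of \<open>x\<close>; with
  \<open>C = A\<close> it gives invariance of \<open>A\<close> under every block.\<close>

lemma rev_block_comp_in_ifs_image:
  assumes "\<theta> \<in> words N" "x \<in> C"
  shows "rev_block_comp f \<theta> m k x \<in> (ifs_image N f ^^ k) C"
proof (induction k)
  case (Suc k)
  then show ?case
    using wordsD[OF assms(1), of "m + Suc k"] by (auto simp: ifs_image_def)
qed (simp add: assms)

lemma ifs_image_funpow_fixed: "ifs_image N f A = A \<Longrightarrow> (ifs_image N f ^^ k) A = A"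
  by (induction k) auto

lemma rev_block_comp_add:
  "rev_block_comp f \<theta> m (j + k) x = rev_block_comp f \<theta> (m + j) k (rev_block_comp f \<theta> m j x)"
  by (induction k) (auto simp: add.assoc)

text \<open>The recursion of \<open>prefix_comp\<close> splits off the innermost map, that of
  \<open>rev_block_comp\<close> the outermost. Splitting the block after its first letter aligns
  them and shifts \<open>m\<close>, hence the generalisation over \<open>m\<close>.\<close>

lemma rev_block_comp_eq_prefix_comp:
  assumes "\<And>i. i \<in> {1..L} \<Longrightarrow> \<omega> i = \<theta> (m + L + 1 - i)"
  shows "rev_block_comp f \<theta> m L x = prefix_comp f \<omega> L x"
  using assms
proof (induction L arbitrary: m x)
  case (Suc L)
  have "rev_block_comp f \<theta> m (Suc L) x = rev_block_comp f \<theta> (Suc m) L (f (\<theta> (Suc m)) x)"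
    using rev_block_comp_add[of f \<theta> m 1 L x] by simp
  also have "\<dots> = prefix_comp f \<omega> L (f (\<theta> (Suc m)) x)"
    using Suc.prems by (intro Suc.IH) auto
  also have "\<theta> (Suc m) = \<omega> (Suc L)"
    using Suc.prems[of "Suc L"] by simp
  finally show ?case
    by simp
qed simp

text \<open>The inverses cancel from the outermost map inwards. This turns an orbit that hits
  \<open>A\<close> into membership in the continuation.\<close>

lemma prefix_comp_inv_rev_block_comp:
  assumes "ifs N f" "\<theta> \<in> words N"
  shows "prefix_comp (\<lambda>n. inv (f n)) \<theta> k (rev_block_comp f \<theta> 0 k x) = x"
proof (induction k)
  case (Suc k)
  then show ?case
    using ifs_inv[OF assms(1) wordsD[OF assms(2), of "Suc k"]] by simp
qed simp

lemma attractor_subset_basin: "attractor N f A \<Longrightarrow> A \<subseteq> basin N f A"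
  by (auto simp: attractor_def basin_def attracts_on_def)

section \<open>The coding map, and reversibility of full words\<close>

text \<open>Testing on singletons identifies the limit given by point-fibredness with the value
  chosen by \<open>THE\<close>. A point of \<open>C\<close> makes the basin nonempty, without which
  uniqueness would fail.\<close>

lemma point_fibred_coding_map:
  assumes pf: "point_fibred N f A" and \<omega>: "\<omega> \<in> words N"
    and C: "compact C" "C \<noteq> {}" "C \<subseteq> basin N f A"
  shows "hausdorff_tendsto (\<lambda>k. prefix_comp f \<omega> k ` C) {coding_map N f A \<omega>}"
proof -
  obtain a where a: "\<And>C. C \<in> nonempty_compacts \<Longrightarrow> C \<subseteq> basin N f A \<Longrightarrow>
      hausdorff_tendsto (\<lambda>k. prefix_comp f \<omega> k ` C) {a}"
    using pf \<omega> unfolding point_fibred_def by blast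
  have lim: "(\<lambda>k. prefix_comp f \<omega> k b) \<longlonglongrightarrow> a" if "b \<in> basin N f A" for b
    using a[of "{b}"] that
    by (intro hausdorff_tendsto_singletons) (simp add: nonempty_compacts_def)
  obtain b where "b \<in> basin N f A"
    using C by auto
  then have "coding_map N f A \<omega> = a"
    unfolding coding_map_def using lim LIMSEQ_unique by (intro the_equality) blast+
  then show ?thesis
    using a C by (simp add: nonempty_compacts_def)
qed

text \<open>Koenig's argument on the blocks of \<theta> read backwards from positions in
  \<open>S\<close>: at each length, the pigeonhole principle over the \<open>N\<close> letters keeps
  infinitely many positions.\<close>

lemma infinite_reversed_prefixes:
  fixes \<theta> :: "nat \<Rightarrow> nat"
  assumes \<theta>: "\<theta> \<in> words N" and S: "infinite S"
  obtains \<omega> where "\<omega> \<in> words N"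
    "\<And>L. infinite {n \<in> S. \<forall>i\<in>{1..L}. \<omega> i = \<theta> (n + 1 - i)}"
proof -
  \<comment> \<open>\<open>T L\<close> consists of positions \<open>n\<close> for which the last \<open>L\<close> letters of \<open>\<theta>\<close> up to \<open>n\<close> agree.\<close>
  have "\<exists>T. \<forall>L. (infinite (T L) \<and> T L \<subseteq> S) \<and>
      (T (Suc L) \<subseteq> T L \<and> (\<exists>a\<in>{1..N}. \<forall>n\<in>T (Suc L). \<theta> (n - L) = a))"
  proof (rule dependent_nat_choice)
    fix T :: "nat set" and L assume T: "infinite T \<and> T \<subseteq> S"
    \<comment> \<open>Discarding \<open>n \<le> L\<close> keeps \<open>n - L\<close> at least 1,
      away from the meaningless letter \<open>\<theta> 0\<close>.\<close>
    then have inf: "infinite (T \<inter> {L<..})"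
      using finite_subset[of T "T \<inter> {L<..} \<union> {..L}"] by fastforce
    have fin: "(\<lambda>n. \<theta> (n - L)) ` (T \<inter> {L<..}) \<subseteq> {1..N}"
      using wordsD[OF \<theta>] by force
    then have "finite ((\<lambda>n. \<theta> (n - L)) ` (T \<inter> {L<..}))"
      by (rule finite_subset) simp
    then obtain n0 where n0: "n0 \<in> T \<inter> {L<..}"
        "infinite {n \<in> T \<inter> {L<..}. \<theta> (n - L) = \<theta> (n0 - L)}"
      using pigeonhole_infinite[OF inf] by blast
    have "\<theta> (n0 - L) \<in> {1..N}"
      using fin n0(1) by blast
    then show "\<exists>T'. (infinite T' \<and> T' \<subseteq> S) \<and>
        (T' \<subseteq> T \<and> (\<exists>a\<in>{1..N}. \<forall>n\<in>T'. \<theta> (n - L) = a))"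
      using n0(2) T by (intro exI[of _ "{n \<in> T \<inter> {L<..}. \<theta> (n - L) = \<theta> (n0 - L)}"]) auto
  qed (use S in auto)
  then obtain T where T: "\<And>L. infinite (T L)" "\<And>L. T L \<subseteq> S" "\<And>L. T (Suc L) \<subseteq> T L"
      "\<And>L. \<exists>a\<in>{1..N}. \<forall>n\<in>T (Suc L). \<theta> (n - L) = a"
    by blast
  obtain a where a: "\<And>L. a L \<in> {1..N}" "\<And>L n. n \<in> T (Suc L) \<Longrightarrow> \<theta> (n - L) = a L"
    using T(4) by metis
  have "decseq T"
    using T(3) by (auto simp: decseq_Suc_iff)
  show thesis
  proof
    show "(\<lambda>i. a (i - 1)) \<in> words N"
      using a(1) by (simp add: words_def)
    show "infinite {n \<in> S. \<forall>i\<in>{1..L}. a (i - 1) = \<theta> (n + 1 - i)}" for L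
    proof (rule infinite_super[OF _ T(1)[of L]], safe)
      fix n i assume n: "n \<in> T L" and i: "i \<in> {1..L}"
      then have "n \<in> T (Suc (i - 1))"
        using decseqD[OF \<open>decseq T\<close>, of i L] by auto
      from a(2)[OF this] i show "a (i - 1) = \<theta> (n + 1 - i)"
        by (simp add: Suc_diff_le)
    qed (use T(2) in auto)
  qed
qed

lemma full_word_imp_reversible_word:
  fixes f :: "nat \<Rightarrow> 'a::complete_space \<Rightarrow> 'a"
  assumes ifs: "ifs N f" and att: "attractor N f A" and pf: "point_fibred N f A"
    and \<theta>: "\<theta> \<in> words N" and full: "full_word f A \<theta>"
  shows "reversible_word N f A \<theta>"
proof -
  have A: "compact A" "A \<noteq> {}" "ifs_image N f A = A"
    using att by (auto simp: attractor_def nonempty_compacts_def)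
  obtain A' where A': "compact A'" "A' \<subseteq> interior A"
      "\<And>M. M \<ge> 1 \<Longrightarrow> \<exists>m n. n > m \<and> m \<ge> M \<and> rev_block_comp f \<theta> m (n - m) ` A \<subseteq> A'"
    using full by (auto simp: full_word_def nonempty_compacts_def)
  have inv: "rev_block_comp f \<theta> m k x \<in> A" if "x \<in> A" for m k x
    using rev_block_comp_in_ifs_image[OF \<theta> that] ifs_image_funpow_fixed[OF A(3)] by blast
  \<comment> \<open>Blocks may be taken to start at 0: the letters before \<open>m\<close> map
    \<open>A\<close> into itself, so only the end position \<open>n\<close> has to be
    recorded.\<close>
  define S where "S = {n. rev_block_comp f \<theta> 0 n ` A \<subseteq> A'}"
  have "infinite S"
    unfolding infinite_nat_iff_unbounded
  proof
    fix M
    obtain m n where mn: "n > m" "m \<ge> Suc M" "rev_block_comp f \<theta> m (n - m) ` A \<subseteq> A'"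
      using A'(3)[of "Suc M"] by auto
    have "rev_block_comp f \<theta> 0 n x \<in> A'" if "x \<in> A" for x
      using rev_block_comp_add[of f \<theta> 0 m "n - m" x] inv[OF that] mn by auto
    then show "\<exists>n>M. n \<in> S"
      using mn by (intro exI[of _ n]) (auto simp: S_def)
  qed
  from infinite_reversed_prefixes[OF \<theta> this] obtain \<omega> where \<omega>: "\<omega> \<in> words N"
      and inf: "\<And>L. infinite {n \<in> S. \<forall>i\<in>{1..L}. \<omega> i = \<theta> (n + 1 - i)}"
    by blast
  have occ: "\<exists>m\<ge>M. m + L \<in> S \<and> (\<forall>i\<in>{1..L}. \<omega> i = \<theta> (m + L + 1 - i))" for M L
  proof -
    obtain n where "n > M + L" "n \<in> S" "\<forall>i\<in>{1..L}. \<omega> i = \<theta> (n + 1 - i)"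
      using inf[of L] unfolding infinite_nat_iff_unbounded by blast
    then show ?thesis
      by (intro exI[of _ "n - L"]) auto
  qed
  let ?p = "coding_map N f A \<omega>"
  \<comment> \<open>The first \<open>m\<close> letters of \<theta> keep a point of \<open>A\<close>
    in \<open>A\<close>; the next \<open>L\<close> act as the prefix of \<omega> and bring it into
    \<open>A'\<close>.\<close>
  have meets: "prefix_comp f \<omega> L ` A \<inter> A' \<noteq> {}" for L
  proof -
    obtain m where m: "m + L \<in> S" "\<forall>i\<in>{1..L}. \<omega> i = \<theta> (m + L + 1 - i)"
      using occ[of 0 L] by blast
    obtain x where x: "x \<in> A"
      using A(2) by blast
    have "rev_block_comp f \<theta> 0 (m + L) x = prefix_comp f \<omega> L (rev_block_comp f \<theta> 0 m x)"
      using rev_block_comp_add[of f \<theta> 0 m L x] rev_block_comp_eq_prefix_comp[of L \<omega> \<theta> m] m(2)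
      by simp
    moreover have "rev_block_comp f \<theta> 0 (m + L) x \<in> A'"
      using m(1) x by (auto simp: S_def)
    ultimately show ?thesis
      using inv[OF x, of 0 m] by auto
  qed
  have "?p \<in> A'"
  proof (rule ccontr)
    assume "?p \<notin> A'"
    \<comment> \<open>Since \<open>A'\<close> is closed, its complement would be a neighbourhood of
      \<open>?p\<close> that eventually contains the images of \<open>A\<close>, against
      \<open>meets\<close>.\<close>
    have "eventually (\<lambda>k. prefix_comp f \<omega> k ` A \<subseteq> - A') sequentially"
    proof (rule hausdorff_tendsto_eventually_subset)
      show "hausdorff_tendsto (\<lambda>k. prefix_comp f \<omega> k ` A) {?p}"
        using point_fibred_coding_map[OF pf \<omega>] A attractor_subset_basin[OF att] by blast
    qed (use \<open>?p \<notin> A'\<close> A' A compact_prefix_comp[OF ifs \<omega>]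
          in \<open>auto intro: compact_imp_closed\<close>)
    then show False
      using meets by (auto simp: eventually_sequentially)
  qed
  then show ?thesis
    using \<omega> A'(2) occ unfolding reversible_word_def by blast
qed

theorem theorem4p5:
  fixes N :: nat
    and f :: "nat \<Rightarrow> 'a::complete_space \<Rightarrow> 'a"
    and A :: "'a set"
    and \<theta> :: "nat \<Rightarrow> nat"
  assumes "ifs N f"
    and "attractor N f A"
    and "point_fibred N f A"
    and "\<theta> \<in> words N"
    and "full_word f A \<theta> \<or> reversible_word N f A \<theta>"
  shows "basin N f A \<subseteq> continuation f A \<theta>"
proof
  fix x assume "x \<in> basin N f A"
  then obtain U where U: "attracts_on N f A U" "x \<in> U"
    by (auto simp: basin_def)
  then have UB: "U \<subseteq> basin N f A" "open U" "A \<subseteq> U"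
    by (auto simp: basin_def attracts_on_def)
  have A: "compact A" "A \<noteq> {}"
    using assms(2) by (auto simp: attractor_def nonempty_compacts_def)
  have "reversible_word N f A \<theta>"
    using assms full_word_imp_reversible_word by blast
  then obtain \<omega> where \<omega>: "\<omega> \<in> words N" "coding_map N f A \<omega> \<in> interior A"
      "\<And>M L. M \<ge> 1 \<Longrightarrow> L \<ge> 1 \<Longrightarrow> \<exists>m\<ge>M. \<forall>i\<in>{1..L}. \<omega> i = \<theta> (m + L + 1 - i)"
    unfolding reversible_word_def by blast
  let ?S = "\<lambda>k. (ifs_image N f ^^ k) {x}"
  have S: "compact (?S k)" for k
    by (rule compact_ifs_image[OF assms(1)]) simp
  have "hausdorff_tendsto ?S A"
    using U by (auto simp: attracts_on_def nonempty_compacts_def)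
  then have near: "eventually (\<lambda>k. ?S k \<subseteq> V) sequentially" if "open V" "A \<subseteq> V" for V
    using hausdorff_tendsto_eventually_subset S A that by blast
  then obtain k0 where k0: "\<And>k. k \<ge> k0 \<Longrightarrow> ?S k \<subseteq> U"
    using near[OF UB(2,3)] unfolding eventually_sequentially by blast
  \<comment> \<open>Including \<open>A\<close>, to which the sets \<open>?S k\<close> converge,
    makes the union compact; starting at \<open>k0\<close> keeps it inside \<open>U\<close>.\<close>
  define K where "K = A \<union> (\<Union>k\<in>{k0..}. ?S k)"
  have K: "compact K" "K \<noteq> {}" "K \<subseteq> basin N f A"
    unfolding K_def using compact_Un_UN_tail[OF A(1) S near] A UB k0 by blast+
  have "eventually (\<lambda>k. prefix_comp f \<omega> k ` K \<subseteq> interior A) sequentially"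
    by (rule hausdorff_tendsto_eventually_subset
          [OF point_fibred_coding_map[OF assms(3) \<omega>(1) K]])
      (use \<omega> K compact_prefix_comp[OF assms(1) \<omega>(1)] in auto)
  then obtain L where L: "L \<ge> 1" "prefix_comp f \<omega> L ` K \<subseteq> interior A"
    using eventually_happens[OF eventually_conj[OF eventually_ge_at_top[of 1]]]
    by (metis trivial_limit_sequentially)
  \<comment> \<open>\<open>Suc k0\<close> is at least 1, as reversibility demands, and places the
    orbit point at time \<open>m\<close> in the tail that makes up \<open>K\<close>.\<close>
  obtain m where m: "m \<ge> Suc k0" "\<forall>i\<in>{1..L}. \<omega> i = \<theta> (m + L + 1 - i)"
    using \<omega>(3)[of "Suc k0" L] L by auto
  have "rev_block_comp f \<theta> 0 m x \<in> K"
    using rev_block_comp_in_ifs_image[OF assms(4), of x "{x}" f 0 m] m(1) by (auto simp: K_def)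
  moreover have "rev_block_comp f \<theta> 0 (m + L) x = prefix_comp f \<omega> L (rev_block_comp f \<theta> 0 m x)"
    using rev_block_comp_add[of f \<theta> 0 m L x] rev_block_comp_eq_prefix_comp[of L \<omega> \<theta> m] m(2)
    by simp
  ultimately have "rev_block_comp f \<theta> 0 (m + L) x \<in> A"
    using L(2) interior_subset by auto
  then have "x \<in> prefix_comp (\<lambda>n. inv (f n)) \<theta> (m + L) ` A"
    using prefix_comp_inv_rev_block_comp[OF assms(1,4), of "m + L" x] by (metis imageI)
  then show "x \<in> continuation f A \<theta>"
    using m(1) unfolding continuation_def by (intro UnI2 UN_I[of "m + L"]) auto
qed

end
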